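(* Let $N\geq 1$, let $\mathfrak{g}=\mathfrak{g}_{\mathrm{inn}}$ be the Lie algebra of inner derivations of $\mathcal{K}_N$, with basis $\hat{\partial},\partial_1,\ldots,\partial_N$. Let $\rho_0,\rho_1,\ldots,\rho_N\in\mathbb{R}$ and let $h_0\in\mathcal{K}^\alpha_N$ with $h_0^\ast=h_0$. Let $h$ be the left hermitian form on $\Omega^1_{\mathfrak{g}}$ given by $h(\omega^I d\alpha_I,\eta^J d\alpha_J)=\omega^I h_{IJ}\bar{\eta}^J$ (sums over $I,J=0,\ldots,N$; $\omega^I,\eta^J\in\mathbb{C}$), where $$h_{00}=\rho_0h_0,\qquad h_{0k}=-i\rho_kh_0,\qquad h_{k0}=i\rho_kh_0,\qquad h_{kl}=0\qquad (k,l=1,\ldots,N).$$ Let $\nabla:\mathfrak{g}\times\Omega^1_{\mathfrak{g}}\to\Omega^1_{\mathfrak{g}}$ be the $\mathbb{C}$-bilinear map determined by $$\nabla_{\hat{\partial}}d\alpha_I=\tfrac12 d\alpha_I,\qquad \nabla_{\partial_k}d\alpha_0=-\tfrac12 d\alpha_k,\qquad \nabla_{\partial_k}d\alpha_l=0$$ for $I=0,\ldots,N$ and $k,l=1,\ldots,N$. Then $\nabla$ is a $\ast$-bimodule Levi-Civita connection on $\Omega^1_{\mathfrak{g}}$ compatible with $h$; that is, $\nabla$ is a torsion free $\ast$-bimodule connection compatible with $h$.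
   Context: $\mathcal{K}_N$ is the unital associative $\mathbb{C}$-algebra generated by $e,\alpha_1,\ldots,\alpha_N$ subject to $e^2=e$, $e\alpha_k=\alpha_k$, $\alpha_k e=0$, $\alpha_j\alpha_k=0$ for all $j,k$; the elements $1,e,\alpha_1,\ldots,\alpha_N$ form a vector space basis. It is a $\ast$-algebra (conjugate-linear, anti-multiplicative involution) with $e^\ast=1-e$, $\alpha_i^\ast=\alpha_i$. $\mathcal{K}^\alpha_N$ is the linear span of $\alpha_1,\ldots,\alpha_N$. For a derivation $\partial$, $\partial^\ast(a)=(\partial(a^\ast))^\ast$. Derivations: $\partial_k(e)=i\alpha_k$, $\partial_k(\alpha_l)=0$; $\hat\partial(e)=0$, $\hat\partial(\alpha_l)=\alpha_l$. They span the Lie algebra $\mathfrak{g}_{\mathrm{inn}}$ of inner derivations, and $\partial_k^\ast=\partial_k$, $\hat\partial^\ast=\hat\partial$. $\Omega^1_{\mathfrak{g}}$ is the $\mathcal{K}_N$-bimodule of all finite sums of maps $a\,db:\mathfrak{g}\to\mathcal{K}_N$, $(a\,db)(\partial)=a\,\partial(b)$, with $(a\omega)(\partial)=a\,\omega(\partial)$, $(\omega a)(\partial)=\omega(\partial)a$ and involution $\omega^\ast(\partial)=\omega(\partial^\ast)^\ast$. Put $d\alpha_0:=i\,de$. For $\mathfrak{g}=\mathfrak{g}_{\mathrm{inn}}$ the forms $d\alpha_0,d\alpha_1,\ldots,d\alpha_N$ are a complex vector space basis of $\Omega^1_{\mathfrak{g}}$. A left connection is a map $\nabla:\mathfrak{g}\times\Omega^1_{\mathfrak{g}}\to\Omega^1_{\mathfrak{g}}$,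 additive in both arguments, $\mathbb{C}$-linear in $\partial$, with $\nabla_\partial(a\omega)=a\nabla_\partial\omega+\partial(a)\omega$; a right connection satisfies instead $\nabla_\partial(\omega a)=(\nabla_\partial\omega)a+\omega\,\partial(a)$; a bimodule connection is both. A $\ast$-bimodule connection is a left connection with $(\nabla_\partial\omega)^\ast=\nabla_{\partial^\ast}\omega^\ast$ (it is then automatically a bimodule connection). The connection is torsion free if $(\nabla_\partial\omega)(\partial')-(\nabla_{\partial'}\omega)(\partial)-d\omega(\partial,\partial')=0$ for all $\omega,\partial,\partial'$, where $d\omega(\partial,\partial')=\partial(\omega(\partial'))-\partial'(\omega(\partial))-\omega([\partial,\partial'])$. A left hermitian form on a left module $M$ is a map $h:M\times M\to\mathcal{K}_N$, additive in its arguments, with $h(am_1,m_2)=ah(m_1,m_2)$ and $h(m_1,m_2)^\ast=h(m_2,m_1)$. $\nabla$ is compatible with $h$ if $\partial\big(h(\omega,\eta)\big)=h(\nabla_\partial\omega,\eta)+h(\omega,\nabla_{\partial^\ast}\eta)$ for all $\partial\in\mathfrak{g}$, $\omega,\eta\in\Omega^1_{\mathfrak{g}}$. *)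

theory Defs
  imports Complex_Main "HOL-Library.Function_Algebras"
begin

section \<open>Complex scalars\<close>

text \<open>Scalar multiplication is overloaded, so that it is available for the algebra as well as
  (pointwise) for derivations and one-forms, which are functions.  Addition of functions is the
  pointwise one of \<^theory>\<open>HOL-Library.Function_Algebras\<close>.\<close>

class scaleC =
  fixes scaleC :: "complex \<Rightarrow> 'a \<Rightarrow> 'a"  (infixr "*\<^sub>C" 75)

instantiation "fun" :: (type, scaleC) scaleC
begin
definition scaleC_fun_def: "c *\<^sub>C f = (\<lambda>x. c *\<^sub>C f x)"
instance ..
end

lemma scaleC_apply [simp]: "(c *\<^sub>C f) x = c *\<^sub>C f x"
  by (simp add: scaleC_fun_def)


section \<open>The algebra\<close>

text \<open>The finite index type \<open>'n\<close> plays the role of \<open>{1..N}\<close>; it is nonempty, so \<open>N \<ge> 1\<close>.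
  \<open>Kn x y z\<close> stands for \<open>x 1 + y e + (\<Sum>k. z k \<alpha>\<^sub>k)\<close> (lemma \<open>kn_expand\<close>).  That this is the
  algebra presented by the generators \<open>e, \<alpha>\<^sub>k\<close> and the given relations is shown by the universal
  property in lemma \<open>kn_universal\<close>.\<close>

datatype 'n kn = Kn (coef1: complex) (coefe: complex) (coefa: "'n \<Rightarrow> complex")

instantiation kn :: (finite) ring_1
begin
definition "0 = Kn 0 0 (\<lambda>_. 0)"
definition "1 = Kn 1 0 (\<lambda>_. 0)"
definition "a + b = Kn (coef1 a + coef1 b) (coefe a + coefe b) (\<lambda>k. coefa a k + coefa b k)"
definition "a - b = Kn (coef1 a - coef1 b) (coefe a - coefe b) (\<lambda>k. coefa a k - coefa b k)"
definition "- a = Kn (- coef1 a) (- coefe a) (\<lambda>k. - coefa a k)"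
definition "a * b =
  Kn (coef1 a * coef1 b)
     (coef1 a * coefe b + coefe a * coef1 b + coefe a * coefe b)
     (\<lambda>k. (coef1 a + coefe a) * coefa b k + coefa a k * coef1 b)"
instance
  by standard
    (auto simp: zero_kn_def one_kn_def plus_kn_def minus_kn_def uminus_kn_def times_kn_def
      fun_eq_iff algebra_simps)
end

instantiation kn :: (type) scaleC
begin
definition scaleC_kn_def: "c *\<^sub>C a = Kn (c * coef1 a) (c * coefe a) (\<lambda>k. c * coefa a k)"
instance ..
end

definition idem :: "'n kn" where
  "idem = Kn 0 1 (\<lambda>_. 0)"

definition alpha :: "'n \<Rightarrow> 'n kn" where
  "alpha k = Kn 0 0 (\<lambda>l. if l = k then 1 else 0)"

definition star :: "'n kn \<Rightarrow> 'n kn" where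
  "star a = Kn (cnj (coef1 a) + cnj (coefe a)) (- cnj (coefe a)) (\<lambda>k. cnj (coefa a k))"

definition Kalpha :: "'n::finite kn set" where
  "Kalpha = range (\<lambda>c. \<Sum>k\<in>UNIV. c k *\<^sub>C alpha k)"

lemmas kn_defs = zero_kn_def one_kn_def plus_kn_def minus_kn_def uminus_kn_def times_kn_def
  scaleC_kn_def idem_def alpha_def star_def

lemma kn_eq_iff: "a = b \<longleftrightarrow> coef1 a = coef1 b \<and> coefe a = coefe b \<and> (\<forall>k. coefa a k = coefa b k)"
  by (cases a; cases b) (auto simp: fun_eq_iff)

lemma coef_sum [simp]:
  fixes f :: "'i \<Rightarrow> 'n::finite kn"
  shows "coef1 (sum f S) = (\<Sum>i\<in>S. coef1 (f i))"
    and "coefe (sum f S) = (\<Sum>i\<in>S. coefe (f i))"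
    and "coefa (sum f S) k = (\<Sum>i\<in>S. coefa (f i) k)"
  by (induction S rule: infinite_finite_induct) (auto simp: kn_defs)

lemma kn_vector_space: "vector_space (scaleC :: complex \<Rightarrow> 'n::finite kn \<Rightarrow> 'n kn)"
  by standard (auto simp: kn_defs fun_eq_iff algebra_simps)

lemma kn_scaleC_mult:
  fixes a b :: "'n::finite kn"
  shows "c *\<^sub>C (a * b) = (c *\<^sub>C a) * b" and "c *\<^sub>C (a * b) = a * (c *\<^sub>C b)"
  by (auto simp: kn_defs fun_eq_iff algebra_simps)

lemma kn_relations:
  fixes j k :: "'n::finite"
  shows "idem * idem = (idem :: 'n kn)" and "idem * alpha k = alpha k"
    and "alpha k * idem = 0" and "alpha j * alpha k = 0"
  by (auto simp: kn_defs fun_eq_iff)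

lemma kn_expand:
  fixes x y :: complex and z :: "'n::finite \<Rightarrow> complex"
  shows "Kn x y z = x *\<^sub>C 1 + y *\<^sub>C idem + (\<Sum>k\<in>UNIV. z k *\<^sub>C alpha k)"
  by (simp add: kn_eq_iff) (simp add: kn_defs if_distrib[of "\<lambda>x. _ * x"] cong: if_cong)

lemma kn_basis:
  fixes a :: "'n::finite kn"
  shows "\<exists>!(x, y, z). a = x *\<^sub>C 1 + y *\<^sub>C idem + (\<Sum>k\<in>UNIV. z k *\<^sub>C alpha k)"
  by (cases a) (auto simp flip: kn_expand)

lemma kn_universal:
  fixes s :: "complex \<Rightarrow> 'b \<Rightarrow> 'b::{ring, monoid_mult}" and E :: 'b and A :: "'n::finite \<Rightarrow> 'b"
  assumes vs: "vector_space s"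
    and s_mult: "\<And>c x y. s c (x * y) = s c x * y" "\<And>c x y. s c (x * y) = x * s c y"
    and rel: "E * E = E" "\<And>k. E * A k = A k" "\<And>k. A k * E = 0" "\<And>j k. A j * A k = 0"
  shows "\<exists>!f :: 'n kn \<Rightarrow> 'b.
    (\<forall>a b. f (a + b) = f a + f b) \<and> (\<forall>c a. f (c *\<^sub>C a) = s c (f a)) \<and>
    (\<forall>a b. f (a * b) = f a * f b) \<and> f 1 = 1 \<and> f idem = E \<and> (\<forall>k. f (alpha k) = A k)"
proof -
  interpret V: vector_space s by (fact vs)
  define F :: "'n kn \<Rightarrow> 'b"
    where "F a = s (coef1 a) 1 + s (coefe a) E + (\<Sum>k\<in>UNIV. s (coefa a k) (A k))" for a
  have sm: "s c x * s d y = s (c * d) (x * y)" for c d x y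
    by (metis V.scale_scale s_mult)
  have F_alpha: "F (alpha k) = A k" for k
  proof -
    have "(\<Sum>l\<in>UNIV. s (if l = k then 1 else 0) (A l)) = (\<Sum>l\<in>UNIV. if l = k then A l else 0)"
      by (rule sum.cong) auto
    then show ?thesis by (simp add: F_def alpha_def)
  qed
  have F_mult: "F (a * b) = F a * F b" for a b
  proof -
    obtain x y z where a: "a = Kn x y z" by (cases a)
    obtain x' y' z' where b: "b = Kn x' y' z'" by (cases b)
    have "F a * F b = s (x * x') 1 + s (x * y') E + (\<Sum>k\<in>UNIV. s (x * z' k) (A k))
       + (s (y * x') E + s (y * y') E + (\<Sum>k\<in>UNIV. s (y * z' k) (A k)))
       + (\<Sum>k\<in>UNIV. s (z k * x') (A k))"
      by (simp add: a b F_def distrib_left distrib_right sum_distrib_left sum_distrib_right sm rel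
          sum.neutral sum.distrib add.assoc)
    also have "\<dots> = F (a * b)"
      by (simp add: a b F_def times_kn_def V.scale_left_distrib distrib_left distrib_right sum.distrib
          ac_simps)
    finally show ?thesis ..
  qed
  show ?thesis
  proof (rule ex1I[of _ F], intro conjI allI)
    show "F (a + b) = F a + F b" for a b
      by (simp add: F_def plus_kn_def V.scale_left_distrib sum.distrib algebra_simps)
    show "F (c *\<^sub>C a) = s c (F a)" for c a
      by (simp add: F_def scaleC_kn_def V.scale_right_distrib V.scale_sum_right)
    show "F (a * b) = F a * F b" for a b by (fact F_mult)
    show "F 1 = 1" by (simp add: F_def one_kn_def)
    show "F idem = E" by (simp add: F_def idem_def)
    show "F (alpha k) = A k" for k by (fact F_alpha)
  next
    fix f :: "'n kn \<Rightarrow> 'b"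
    assume f: "(\<forall>a b. f (a + b) = f a + f b) \<and> (\<forall>c a. f (c *\<^sub>C a) = s c (f a)) \<and>
      (\<forall>a b. f (a * b) = f a * f b) \<and> f 1 = 1 \<and> f idem = E \<and> (\<forall>k. f (alpha k) = A k)"
    then have add: "f (a + b) = f a + f b" for a b by blast
    have "f 0 = 0" using add[of 0 0] by simp
    then have f_sum: "f (sum g S) = (\<Sum>k\<in>S. f (g k))" for g and S :: "'n set"
      by (induction S rule: infinite_finite_induct) (auto simp: add)
    show "f = F"
    proof
      fix a :: "'n kn"
      have "a = coef1 a *\<^sub>C 1 + coefe a *\<^sub>C idem + (\<Sum>k\<in>UNIV. coefa a k *\<^sub>C alpha k)"
        by (metis kn.collapse kn_expand)
      then have "f a = f (coef1 a *\<^sub>C 1 + coefe a *\<^sub>C idem + (\<Sum>k\<in>UNIV. coefa a k *\<^sub>C alpha k))"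
        by simp
      also have "\<dots> = F a" using f by (simp add: F_def add f_sum)
      finally show "f a = F a" .
    qed
  qed
qed

lemma star_involution:
  fixes a b :: "'n::finite kn"
  shows "star (a + b) = star a + star b" and "star (c *\<^sub>C a) = cnj c *\<^sub>C star a"
    and "star (a * b) = star b * star a" and "star (star a) = a"
    and "star idem = 1 - (idem :: 'n kn)" and "star (alpha k) = (alpha k :: 'n kn)"
  by (auto simp: kn_defs kn_eq_iff algebra_simps)


section \<open>Derivations\<close>

type_synonym 'n der = "'n kn \<Rightarrow> 'n kn"

definition derivation :: "'n::finite der \<Rightarrow> bool" where
  "derivation D \<longleftrightarrow>
    (\<forall>a b. D (a + b) = D a + D b) \<and> (\<forall>c a. D (c *\<^sub>C a) = c *\<^sub>C D a) \<and>
    (\<forall>a b. D (a * b) = a * D b + D a * b)"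

definition inner_der :: "'n::finite kn \<Rightarrow> 'n der" where
  "inner_der x = (\<lambda>a. x * a - a * x)"

definition g_inn :: "'n::finite der set" where
  "g_inn = range inner_der"

definition bracket :: "'n::finite der \<Rightarrow> 'n der \<Rightarrow> 'n der" where
  "bracket D D' = (\<lambda>a. D (D' a) - D' (D a))"

definition der_star :: "'n der \<Rightarrow> 'n der" where
  "der_star D = (\<lambda>a. star (D (star a)))"

text \<open>The basis derivations; lemmas \<open>pd_iff\<close> and \<open>dhat_iff\<close> characterise them by their values on
  the generators.\<close>

definition pd :: "'n \<Rightarrow> 'n der" where
  "pd k = (\<lambda>a. (\<i> * coefe a) *\<^sub>C alpha k)"

definition dhat :: "'n der" where
  "dhat = (\<lambda>a. Kn 0 0 (coefa a))"

lemma derivation_on_gens: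
  fixes D :: "'n::finite der"
  assumes D: "derivation D"
  shows "D a = coefe a *\<^sub>C D idem + (\<Sum>k\<in>UNIV. coefa a k *\<^sub>C D (alpha k))"
proof -
  have add: "D (a + b) = D a + D b" and scl: "D (c *\<^sub>C a) = c *\<^sub>C D a"
    and lei: "D (a * b) = a * D b + D a * b" for a b c
    using D by (auto simp: derivation_def)
  have D_1: "D 1 = 0" using lei[of 1 1] by simp
  have "D 0 = 0" using add[of 0 0] by simp
  then have D_sum: "D (sum g S) = (\<Sum>k\<in>S. D (g k))" for g and S :: "'n set"
    by (induction S rule: infinite_finite_induct) (auto simp: add)
  have "a = coef1 a *\<^sub>C 1 + coefe a *\<^sub>C idem + (\<Sum>k\<in>UNIV. coefa a k *\<^sub>C alpha k)"
    by (metis kn.collapse kn_expand)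
  then have "D a = D (coef1 a *\<^sub>C 1 + coefe a *\<^sub>C idem + (\<Sum>k\<in>UNIV. coefa a k *\<^sub>C alpha k))"
    by simp
  also have "\<dots> = coef1 a *\<^sub>C D 1 + coefe a *\<^sub>C D idem + (\<Sum>k\<in>UNIV. coefa a k *\<^sub>C D (alpha k))"
    by (simp only: add scl D_sum)
  finally show ?thesis using D_1 by (simp add: kn_defs)
qed

lemma derivation_inner_der: "derivation (inner_der x)"
  by (auto simp: derivation_def inner_der_def kn_defs fun_eq_iff algebra_simps)

lemma pd_eq_inner_der: "pd k = inner_der ((- \<i>) *\<^sub>C alpha k)"
  by (auto simp: pd_def inner_der_def kn_defs fun_eq_iff algebra_simps)

lemma dhat_eq_inner_der: "dhat = inner_der idem"
  by (auto simp: dhat_def inner_der_def kn_defs fun_eq_iff algebra_simps)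

lemma pd_iff: "D = pd k \<longleftrightarrow> derivation D \<and> D idem = \<i> *\<^sub>C alpha k \<and> (\<forall>l. D (alpha l) = 0)"
proof safe
  show "derivation (pd k)" by (simp add: pd_eq_inner_der derivation_inner_der)
  show "pd k idem = \<i> *\<^sub>C alpha k" "pd k (alpha l) = 0" for l
    by (auto simp: pd_def kn_defs)
next
  assume D: "derivation D" "D idem = \<i> *\<^sub>C alpha k" "\<forall>l. D (alpha l) = 0"
  show "D = pd k"
  proof
    fix a show "D a = pd k a"
      using D(2,3) by (subst derivation_on_gens[OF D(1)]) (simp add: pd_def kn_eq_iff, simp add: kn_defs)
  qed
qed

lemma dhat_iff:
  fixes D :: "'n::finite der"
  shows "D = dhat \<longleftrightarrow> derivation D \<and> D idem = 0 \<and> (\<forall>l. D (alpha l) = alpha l)"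
proof safe
  show "derivation (dhat :: 'n der)" by (simp add: dhat_eq_inner_der derivation_inner_der)
  show "(dhat idem :: 'n kn) = 0" "(dhat (alpha l) :: 'n kn) = alpha l" for l
    by (auto simp: dhat_def kn_defs)
next
  assume D: "derivation D" "D idem = 0" "\<forall>l. D (alpha l) = alpha l"
  show "D = dhat"
  proof
    fix a show "D a = dhat a"
      using D(2,3) by (subst derivation_on_gens[OF D(1)])
        (simp add: dhat_def kn_eq_iff, simp add: kn_defs if_distrib[of "\<lambda>x. _ * x"] cong: if_cong)
  qed
qed


lemma g_inn_span:
  "(g_inn :: 'n::finite der set) = {c *\<^sub>C dhat + (\<Sum>k\<in>UNIV. d k *\<^sub>C pd k) | c d. True}" (is "?L = ?R")
proof -
  have sum_apply: "(\<Sum>k\<in>S. d k *\<^sub>C pd k) a = (\<Sum>k\<in>S. d k *\<^sub>C pd k a)"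
    for S :: "'n::finite set" and d and a :: "'n kn"
    by (induction S rule: infinite_finite_induct) auto
  have eq: "inner_der x = coefe x *\<^sub>C dhat + (\<Sum>k\<in>UNIV. (\<i> * coefa x k) *\<^sub>C pd k)"
    for x :: "'n::finite kn"
    by (rule ext, simp add: sum_apply, simp add: kn_eq_iff,
        simp add: inner_der_def dhat_def pd_def kn_defs if_distrib[of "\<lambda>x. _ * x"] algebra_simps
          cong: if_cong)
  show ?thesis
  proof (intro equalityI subsetI)
    fix D :: "'n der" assume "D \<in> ?L"
    then obtain x where "D = inner_der x" by (auto simp: g_inn_def)
    then show "D \<in> ?R" using eq[of x] by (intro CollectI exI conjI TrueI) simp
  next
    fix D :: "'n der" assume "D \<in> ?R"
    then obtain c d where "D = c *\<^sub>C dhat + (\<Sum>k\<in>UNIV. d k *\<^sub>C pd k)" by blast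
    also have "\<dots> = inner_der (Kn 0 c (\<lambda>k. - \<i> * d k))" by (simp add: eq)
    finally show "D \<in> ?L" by (simp add: g_inn_def)
  qed
qed


section \<open>One-forms\<close>

text \<open>A one-form on \<open>\<gg>\<close> is a map defined on \<open>\<gg>\<close> only.  It is represented by the function that
  is \<open>0\<close> outside \<open>\<gg>\<close>, so that forms are equal iff they agree on \<open>\<gg>\<close>.\<close>

type_synonym 'n form = "'n der \<Rightarrow> 'n kn"

definition basic_form :: "'n::finite der set \<Rightarrow> 'n kn \<Rightarrow> 'n kn \<Rightarrow> 'n form" where
  "basic_form g a b = (\<lambda>D. if D \<in> g then a * D b else 0)"

definition Omega1 :: "'n::finite der set \<Rightarrow> 'n form set" where
  "Omega1 g = {\<omega>. \<exists>(m::nat) a b. \<omega> = (\<Sum>i<m. basic_form g (a i) (b i))}"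

definition diff :: "'n::finite der set \<Rightarrow> 'n kn \<Rightarrow> 'n form" where
  "diff g b = basic_form g 1 b"

definition lmul :: "'n::finite kn \<Rightarrow> 'n form \<Rightarrow> 'n form" where
  "lmul a \<omega> = (\<lambda>D. a * \<omega> D)"

definition rmul :: "'n::finite form \<Rightarrow> 'n kn \<Rightarrow> 'n form" where
  "rmul \<omega> a = (\<lambda>D. \<omega> D * a)"

definition form_star :: "'n form \<Rightarrow> 'n form" where
  "form_star \<omega> = (\<lambda>D. star (\<omega> (der_star D)))"

definition ext_d :: "'n::finite form \<Rightarrow> 'n der \<Rightarrow> 'n der \<Rightarrow> 'n kn" where
  "ext_d \<omega> D D' = D (\<omega> D') - D' (\<omega> D) - \<omega> (bracket D D')"

text \<open>The indices \<open>0, 1, \<dots>, N\<close> are \<open>None\<close> and \<open>Some k\<close>.\<close>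

fun dalpha :: "'n::finite der set \<Rightarrow> 'n option \<Rightarrow> 'n form" where
  "dalpha g None = \<i> *\<^sub>C diff g idem"
| "dalpha g (Some k) = diff g (alpha k)"


lemma sum_fun_apply:
  fixes f :: "'i \<Rightarrow> 'a \<Rightarrow> 'b::comm_monoid_add"
  shows "(\<Sum>i\<in>S. f i) x = (\<Sum>i\<in>S. f i x)"
  by (induction S rule: infinite_finite_induct) auto

lemma sum_option:
  fixes f :: "'n::finite option \<Rightarrow> 'b::comm_monoid_add"
  shows "(\<Sum>I\<in>UNIV. f I) = f None + (\<Sum>k\<in>UNIV. f (Some k))"
  by (simp add: UNIV_option_conv sum.reindex)

lemma dalpha_apply:
  assumes "D \<in> g"
  shows "dalpha g None D = \<i> *\<^sub>C D idem" and "dalpha g (Some k) D = D (alpha k)"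
  using assms by (simp_all add: diff_def basic_form_def)

lemma dalpha_outside: "D \<notin> g \<Longrightarrow> dalpha g I D = 0"
  by (cases I) (simp_all add: diff_def basic_form_def kn_defs)

lemma g_inn_memI: "dhat \<in> g_inn" "pd k \<in> g_inn"
  by (auto simp: g_inn_def dhat_eq_inner_der pd_eq_inner_der)

lemma g_inn_derivation: "D \<in> g_inn \<Longrightarrow> derivation D"
  by (auto simp: g_inn_def derivation_inner_der)

lemma basic_form_in: "basic_form g a b \<in> Omega1 g"
  unfolding Omega1_def by (intro CollectI exI[of _ "1::nat"] exI[of _ "\<lambda>_. a"] exI[of _ "\<lambda>_. b"]) simp

lemma Omega1_add:
  assumes "\<omega> \<in> Omega1 g" "\<eta> \<in> Omega1 g"
  shows "\<omega> + \<eta> \<in> Omega1 g"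
proof -
  obtain m :: nat and a b where 1: "\<omega> = (\<Sum>i<m. basic_form g (a i) (b i))"
    using assms(1) by (auto simp: Omega1_def)
  obtain n :: nat and a' b' where 2: "\<eta> = (\<Sum>i<n. basic_form g (a' i) (b' i))"
    using assms(2) by (auto simp: Omega1_def)
  define A where "A i = (if i < m then a i else a' (i - m))" for i
  define B where "B i = (if i < m then b i else b' (i - m))" for i
  have "(\<Sum>i<m + k. basic_form g (A i) (B i)) = \<omega> + (\<Sum>i<k. basic_form g (a' i) (b' i))" for k
    by (induction k) (simp_all add: 1 A_def B_def add.assoc)
  then show ?thesis unfolding Omega1_def 2 by (metis (mono_tags, lifting) mem_Collect_eq)
qed

lemma Omega1_sum:
  assumes "\<And>i. i \<in> S \<Longrightarrow> f i \<in> Omega1 g"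
  shows "(\<Sum>i\<in>S. f i) \<in> Omega1 g"
proof -
  have "0 \<in> Omega1 g"
    unfolding Omega1_def by (intro CollectI exI[of _ "0::nat"]) simp
  then show ?thesis
    using assms by (induction S rule: infinite_finite_induct) (auto intro: Omega1_add)
qed

lemma scaleC_dalpha_in: "c *\<^sub>C dalpha g I \<in> Omega1 g"
proof (cases I)
  case None
  have "c *\<^sub>C dalpha g I = basic_form g ((c * \<i>) *\<^sub>C 1) idem"
    by (rule ext) (simp add: None diff_def basic_form_def kn_defs fun_eq_iff)
  then show ?thesis by (simp add: basic_form_in)
next
  case (Some k)
  have "c *\<^sub>C dalpha g I = basic_form g (c *\<^sub>C 1) (alpha k)"
    by (rule ext) (simp add: Some diff_def basic_form_def kn_defs fun_eq_iff)
  then show ?thesis by (simp add: basic_form_in)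
qed

lemma g_inn_coefs:
  assumes "D \<in> g_inn"
  shows "coef1 (D a) = 0" and "coefe (D a) = 0"
  using assms by (auto simp: g_inn_def inner_der_def kn_defs)

lemma basic_form_expand:
  fixes a b :: "'n::finite kn"
  shows "basic_form g_inn a b = (\<Sum>I\<in>UNIV.
    ((coef1 a + coefe a) * (case I of None \<Rightarrow> - \<i> * coefe b | Some k \<Rightarrow> coefa b k)) *\<^sub>C dalpha g_inn I)"
proof
  fix D :: "'n der"
  show "basic_form g_inn a b D = (\<Sum>I\<in>UNIV.
    ((coef1 a + coefe a) * (case I of None \<Rightarrow> - \<i> * coefe b | Some k \<Rightarrow> coefa b k)) *\<^sub>C dalpha g_inn I) D"
  proof (cases "D \<in> g_inn")
    case True
    have "D b = coefe b *\<^sub>C D idem + (\<Sum>k\<in>UNIV. coefa b k *\<^sub>C D (alpha k))"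
      by (rule derivation_on_gens[OF g_inn_derivation[OF True]])
    then have "a * D b = a * (coefe b *\<^sub>C D idem + (\<Sum>k\<in>UNIV. coefa b k *\<^sub>C D (alpha k)))"
      by simp
    also have "\<dots> = ((coef1 a + coefe a) * coefe b) *\<^sub>C D idem +
        (\<Sum>k\<in>UNIV. ((coef1 a + coefe a) * coefa b k) *\<^sub>C D (alpha k))"
      by (simp add: kn_eq_iff, simp add: times_kn_def plus_kn_def scaleC_kn_def g_inn_coefs[OF True])
        (simp add: sum_distrib_left distrib_left mult.assoc)
    finally show ?thesis
      using True by (simp add: sum_fun_apply sum_option dalpha_apply basic_form_def del: dalpha.simps)
        (simp add: scaleC_kn_def algebra_simps)
  next
    case False
    then show ?thesis
      by (simp add: sum_fun_apply dalpha_outside basic_form_def) (simp add: kn_defs kn_eq_iff)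
  qed
qed

lemma Omega1_basis_sum_eq_iff:
  fixes c d :: "'n::finite option \<Rightarrow> complex"
  shows "(\<Sum>I\<in>UNIV. c I *\<^sub>C dalpha g_inn I) = (\<Sum>I\<in>UNIV. d I *\<^sub>C dalpha g_inn I) \<longleftrightarrow> c = d"
proof
  have at_dhat: "coefa ((\<Sum>I\<in>UNIV. c I *\<^sub>C dalpha g_inn I) dhat) k = c (Some k)"
    for c :: "'n option \<Rightarrow> complex" and k
    by (simp add: sum_fun_apply sum_option dalpha_apply[OF g_inn_memI(1)] plus_kn_def del: dalpha.simps)
      (simp add: dhat_def kn_defs if_distrib[of "\<lambda>x. _ * x"] cong: if_cong)
  have at_pd: "coefa ((\<Sum>I\<in>UNIV. c I *\<^sub>C dalpha g_inn I) (pd k)) k = - c None"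
    for c :: "'n option \<Rightarrow> complex" and k
    by (simp add: sum_fun_apply sum_option dalpha_apply[OF g_inn_memI(2)] plus_kn_def del: dalpha.simps)
      (simp add: pd_def kn_defs)
  assume eq: "(\<Sum>I\<in>UNIV. c I *\<^sub>C dalpha g_inn I) = (\<Sum>I\<in>UNIV. d I *\<^sub>C dalpha g_inn I)"
  have "c I = d I" for I
    using at_dhat[of c] at_dhat[of d] at_pd[of c] at_pd[of d] by (cases I) (auto simp: eq)
  then show "c = d" ..
qed simp

lemma Omega1_basis:
  fixes \<omega> :: "'n::finite form"
  shows "\<omega> \<in> Omega1 g_inn \<longleftrightarrow> (\<exists>!c. \<omega> = (\<Sum>I\<in>UNIV. c I *\<^sub>C dalpha g_inn I))"
proof
  assume "\<omega> \<in> Omega1 g_inn"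
  then obtain m :: nat and a b where "\<omega> = (\<Sum>i<m. basic_form g_inn (a i) (b i))"
    by (auto simp: Omega1_def)
  moreover have "\<exists>c. (\<Sum>i<m. basic_form g_inn (a i) (b i)) = (\<Sum>I\<in>UNIV. c I *\<^sub>C dalpha g_inn I)"
  proof (induction m)
    case 0
    show ?case
      by (rule exI[of _ "\<lambda>_. 0"]) (simp add: sum_fun_apply fun_eq_iff kn_eq_iff, simp add: kn_defs)
  next
    case (Suc m)
    then obtain c where c: "(\<Sum>i<m. basic_form g_inn (a i) (b i)) = (\<Sum>I\<in>UNIV. c I *\<^sub>C dalpha g_inn I)"
      by blast
    have add: "(\<Sum>I\<in>UNIV. c I *\<^sub>C dalpha g_inn I) + (\<Sum>I\<in>UNIV. d I *\<^sub>C dalpha g_inn I)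
        = (\<Sum>I\<in>UNIV. (c I + d I) *\<^sub>C dalpha g_inn I)" for d :: "'n option \<Rightarrow> complex"
      by (simp flip: sum.distrib, rule sum.cong) (auto simp: fun_eq_iff kn_defs algebra_simps)
    obtain d where d: "basic_form g_inn (a m) (b m) = (\<Sum>I\<in>UNIV. d I *\<^sub>C dalpha g_inn I)"
      using basic_form_expand[of "a m" "b m"] by (rule that)
    show ?case
      by (rule exI[of _ "\<lambda>I. c I + d I"]) (simp only: sum.lessThan_Suc c d add)
  qed
  ultimately obtain c where c: "\<omega> = (\<Sum>I\<in>UNIV. c I *\<^sub>C dalpha g_inn I)" by (elim exE) simp
  show "\<exists>!c. \<omega> = (\<Sum>I\<in>UNIV. c I *\<^sub>C dalpha g_inn I)"
    unfolding c Omega1_basis_sum_eq_iff by (intro ex1I[of _ c]) simp_all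
next
  assume "\<exists>!c. \<omega> = (\<Sum>I\<in>UNIV. c I *\<^sub>C dalpha g_inn I)"
  then obtain c where "\<omega> = (\<Sum>I\<in>UNIV. c I *\<^sub>C dalpha g_inn I)" by (elim ex1E)
  then show "\<omega> \<in> Omega1 g_inn" by (simp only: Omega1_sum scaleC_dalpha_in)
qed


section \<open>Connections and hermitian forms\<close>

type_synonym 'n conn = "'n der \<Rightarrow> 'n form \<Rightarrow> 'n form"

definition left_connection :: "'n::finite der set \<Rightarrow> 'n conn \<Rightarrow> bool" where
  "left_connection g nabla \<longleftrightarrow>
    (\<forall>D\<in>g. \<forall>\<omega>\<in>Omega1 g. nabla D \<omega> \<in> Omega1 g) \<and>
    (\<forall>D\<in>g. \<forall>D'\<in>g. \<forall>\<omega>\<in>Omega1 g. nabla (D + D') \<omega> = nabla D \<omega> + nabla D' \<omega>) \<and>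
    (\<forall>D\<in>g. \<forall>\<omega>\<in>Omega1 g. \<forall>\<eta>\<in>Omega1 g. nabla D (\<omega> + \<eta>) = nabla D \<omega> + nabla D \<eta>) \<and>
    (\<forall>c. \<forall>D\<in>g. \<forall>\<omega>\<in>Omega1 g. nabla (c *\<^sub>C D) \<omega> = c *\<^sub>C nabla D \<omega>) \<and>
    (\<forall>a. \<forall>D\<in>g. \<forall>\<omega>\<in>Omega1 g. nabla D (lmul a \<omega>) = lmul a (nabla D \<omega>) + lmul (D a) \<omega>)"

definition right_connection :: "'n::finite der set \<Rightarrow> 'n conn \<Rightarrow> bool" where
  "right_connection g nabla \<longleftrightarrow>
    (\<forall>D\<in>g. \<forall>\<omega>\<in>Omega1 g. nabla D \<omega> \<in> Omega1 g) \<and>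
    (\<forall>D\<in>g. \<forall>D'\<in>g. \<forall>\<omega>\<in>Omega1 g. nabla (D + D') \<omega> = nabla D \<omega> + nabla D' \<omega>) \<and>
    (\<forall>D\<in>g. \<forall>\<omega>\<in>Omega1 g. \<forall>\<eta>\<in>Omega1 g. nabla D (\<omega> + \<eta>) = nabla D \<omega> + nabla D \<eta>) \<and>
    (\<forall>c. \<forall>D\<in>g. \<forall>\<omega>\<in>Omega1 g. nabla (c *\<^sub>C D) \<omega> = c *\<^sub>C nabla D \<omega>) \<and>
    (\<forall>a. \<forall>D\<in>g. \<forall>\<omega>\<in>Omega1 g. nabla D (rmul \<omega> a) = rmul (nabla D \<omega>) a + rmul \<omega> (D a))"

definition bimodule_connection :: "'n::finite der set \<Rightarrow> 'n conn \<Rightarrow> bool" where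
  "bimodule_connection g nabla \<longleftrightarrow> left_connection g nabla \<and> right_connection g nabla"

definition star_bimodule_connection :: "'n::finite der set \<Rightarrow> 'n conn \<Rightarrow> bool" where
  "star_bimodule_connection g nabla \<longleftrightarrow> left_connection g nabla \<and>
    (\<forall>D\<in>g. \<forall>\<omega>\<in>Omega1 g. form_star (nabla D \<omega>) = nabla (der_star D) (form_star \<omega>))"

lemma der_star_der_star: "der_star (der_star D) = (D :: 'n::finite der)"
  by (simp add: der_star_def star_involution)

lemma form_star_form_star: "form_star (form_star \<omega>) = (\<omega> :: 'n::finite form)"
  by (simp add: form_star_def der_star_der_star star_involution)

lemma form_star_add:
  fixes \<omega> \<eta> :: "'n::finite form"
  shows "form_star (\<omega> + \<eta>) = form_star \<omega> + form_star \<eta>"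
  by (rule ext) (simp add: form_star_def star_involution)

lemma form_star_lmul: "form_star (lmul a \<omega>) = rmul (form_star \<omega>) (star a)"
  by (rule ext) (simp add: form_star_def lmul_def rmul_def star_involution)

lemma Omega1_lmul:
  assumes "\<omega> \<in> Omega1 g"
  shows "lmul a \<omega> \<in> Omega1 g"
proof -
  obtain m :: nat and b c where \<omega>: "\<omega> = (\<Sum>i<m. basic_form g (b i) (c i))"
    using assms by (auto simp: Omega1_def)
  have "lmul a \<omega> = (\<Sum>i<m. basic_form g (a * b i) (c i))"
    by (rule ext)
      (auto simp: \<omega> lmul_def sum_fun_apply basic_form_def sum_distrib_left mult.assoc intro!: sum.cong)
  then show ?thesis by (simp only: Omega1_sum basic_form_in)
qed

lemma Omega1_form_star:
  fixes g :: "'n::finite der set"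
  assumes g: "\<And>D. D \<in> g \<Longrightarrow> derivation D \<and> der_star D \<in> g" and "\<omega> \<in> Omega1 g"
  shows "form_star \<omega> \<in> Omega1 g"
proof -
  obtain m :: nat and a b where \<omega>: "\<omega> = (\<Sum>i<m. basic_form g (a i) (b i))"
    using assms(2) by (auto simp: Omega1_def)
  have basic: "form_star (basic_form g a b) =
    basic_form g 1 (star b * star a) + basic_form g (- star b) (star a)" for a b
  proof
    fix D
    show "form_star (basic_form g a b) D =
      (basic_form g 1 (star b * star a) + basic_form g (- star b) (star a)) D"
    proof (cases "D \<in> g")
      case True
      then have "D (star b * star a) = star b * D (star a) + D (star b) * star a"
        using g by (auto simp: derivation_def)
      then show ?thesis
        using True g[OF True]
        by (simp add: form_star_def basic_form_def star_involution) (simp add: der_star_def star_involution)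
    next
      case False
      then have "der_star D \<notin> g" using g[of "der_star D"] by (auto simp: der_star_der_star)
      then show ?thesis using False by (simp add: form_star_def basic_form_def) (simp add: kn_defs)
    qed
  qed
  have "form_star (0 :: 'n form) = 0"
    by (rule ext) (simp add: form_star_def, simp add: kn_defs)
  then have "form_star \<omega> = (\<Sum>i<m. form_star (basic_form g (a i) (b i)))"
    unfolding \<omega> by (induction m) (simp_all only: sum.lessThan_Suc form_star_add lessThan_0 sum.empty)
  then show ?thesis by (simp only: basic Omega1_sum Omega1_add basic_form_in)
qed

lemma star_bimodule_connection_imp_bimodule_connection:
  assumes g: "\<And>D. D \<in> g \<Longrightarrow> derivation D \<and> der_star D \<in> g"
    and "star_bimodule_connection g nabla"
  shows "bimodule_connection g nabla"
proof -
  have star: "form_star (nabla D \<omega>) = nabla (der_star D) (form_star \<omega>)"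
    if "D \<in> g" "\<omega> \<in> Omega1 g" for D \<omega>
    using assms(2) that by (auto simp: star_bimodule_connection_def)
  have left: "left_connection g nabla"
    using assms(2) by (simp add: star_bimodule_connection_def)
  have "nabla D (rmul \<omega> a) = rmul (nabla D \<omega>) a + rmul \<omega> (D a)"
    if D: "D \<in> g" and \<omega>: "\<omega> \<in> Omega1 g" for a D \<omega>
  proof -
    let ?D = "der_star D" and ?w = "form_star \<omega>"
    have D': "?D \<in> g" and w': "?w \<in> Omega1 g"
      using g D \<omega> by (auto intro: Omega1_form_star)
    have "nabla D (rmul \<omega> a) = nabla (der_star ?D) (form_star (lmul (star a) ?w))"
      by (simp add: form_star_lmul form_star_form_star der_star_der_star star_involution)
    also have "\<dots> = form_star (nabla ?D (lmul (star a) ?w))"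
      using D' w' by (simp add: star Omega1_lmul)
    also have "nabla ?D (lmul (star a) ?w) = lmul (star a) (nabla ?D ?w) + lmul (?D (star a)) ?w"
      using left D' w' unfolding left_connection_def by blast
    also have "form_star \<dots> = rmul (form_star (nabla ?D ?w)) a + rmul \<omega> (D a)"
      by (simp add: form_star_add form_star_lmul form_star_form_star star_involution)
        (simp add: der_star_def star_involution)
    also have "form_star (nabla ?D ?w) = nabla D \<omega>"
      using D' w' by (simp add: star der_star_der_star form_star_form_star)
    finally show ?thesis .
  qed
  then show ?thesis
    using left unfolding bimodule_connection_def right_connection_def left_connection_def by blast
qed

definition torsion_free :: "'n::finite der set \<Rightarrow> 'n conn \<Rightarrow> bool" where
  "torsion_free g nabla \<longleftrightarrow>
    (\<forall>\<omega>\<in>Omega1 g. \<forall>D\<in>g. \<forall>D'\<in>g. nabla D \<omega> D' - nabla D' \<omega> D - ext_d \<omega> D D' = 0)"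

definition left_hermitian_form ::
    "'n::finite form set \<Rightarrow> ('n form \<Rightarrow> 'n form \<Rightarrow> 'n kn) \<Rightarrow> bool" where
  "left_hermitian_form M h \<longleftrightarrow>
    (\<forall>\<omega>\<in>M. \<forall>\<omega>'\<in>M. \<forall>\<eta>\<in>M. h (\<omega> + \<omega>') \<eta> = h \<omega> \<eta> + h \<omega>' \<eta>) \<and>
    (\<forall>\<omega>\<in>M. \<forall>\<eta>\<in>M. \<forall>\<eta>'\<in>M. h \<omega> (\<eta> + \<eta>') = h \<omega> \<eta> + h \<omega> \<eta>') \<and>
    (\<forall>a. \<forall>\<omega>\<in>M. \<forall>\<eta>\<in>M. h (lmul a \<omega>) \<eta> = a * h \<omega> \<eta>) \<and>
    (\<forall>\<omega>\<in>M. \<forall>\<eta>\<in>M. star (h \<omega> \<eta>) = h \<eta> \<omega>)"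

definition compatible ::
    "'n::finite der set \<Rightarrow> 'n conn \<Rightarrow> ('n form \<Rightarrow> 'n form \<Rightarrow> 'n kn) \<Rightarrow> bool" where
  "compatible g nabla h \<longleftrightarrow>
    (\<forall>D\<in>g. \<forall>\<omega>\<in>Omega1 g. \<forall>\<eta>\<in>Omega1 g.
      D (h \<omega> \<eta>) = h (nabla D \<omega>) \<eta> + h \<omega> (nabla (der_star D) \<eta>))"

definition bilinear_map :: "'n::finite der set \<Rightarrow> 'n conn \<Rightarrow> bool" where
  "bilinear_map g nabla \<longleftrightarrow>
    (\<forall>D\<in>g. \<forall>\<omega>\<in>Omega1 g. nabla D \<omega> \<in> Omega1 g) \<and>
    (\<forall>D\<in>g. \<forall>D'\<in>g. \<forall>\<omega>\<in>Omega1 g. nabla (D + D') \<omega> = nabla D \<omega> + nabla D' \<omega>) \<and>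
    (\<forall>D\<in>g. \<forall>\<omega>\<in>Omega1 g. \<forall>\<eta>\<in>Omega1 g. nabla D (\<omega> + \<eta>) = nabla D \<omega> + nabla D \<eta>) \<and>
    (\<forall>c. \<forall>D\<in>g. \<forall>\<omega>\<in>Omega1 g. nabla (c *\<^sub>C D) \<omega> = c *\<^sub>C nabla D \<omega>) \<and>
    (\<forall>c. \<forall>D\<in>g. \<forall>\<omega>\<in>Omega1 g. nabla D (c *\<^sub>C \<omega>) = c *\<^sub>C nabla D \<omega>)"

end

theory Submission
  imports Defs
begin

text \<open>Everything reduces to coordinates.  A derivation in \<open>\<gg>\<^sub>i\<^sub>n\<^sub>n\<close> has coordinates \<open>(p, q)\<close>
  (\<open>der_of\<close>), a one-form has coordinates \<open>c\<close> (\<open>form_of\<close>), and both derivations and one-forms take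
  values in the span \<open>\<K>\<^sup>\<alpha>\<close> of the \<open>\<alpha>\<^sub>k\<close>.  Products within \<open>\<K>\<^sup>\<alpha>\<close> vanish, and \<open>x 1 + y e + \<dots>\<close>
  acts on \<open>\<K>\<^sup>\<alpha>\<close> from the left as the scalar \<open>x + y\<close>.  Hence \<open>\<partial>(a) \<omega> = 0\<close> and \<open>a \<omega>\<close> is a scalar
  multiple of \<open>\<omega>\<close>, so for \<open>\<gg>\<^sub>i\<^sub>n\<^sub>n\<close> the Leibniz rule of a left connection says no more than complex
  linearity in \<open>\<omega>\<close> (\<open>left_connection_of_bilinear\<close>).

  The basis derivations and basis forms are all fixed by the involutions, so those act on
  coordinates by complex conjugation, and \<open>\<nabla>\<close> is a \<open>*\<close>-connection because its coefficients
  \<open>\<plusminus>1/2\<close> are real.  The torsion vanishes because every one-form is closed (\<open>ext_d_form_of\<close>) and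
  \<open>(\<nabla>\<^sub>\<partial> \<omega>)(\<partial>')\<close> is symmetric in \<open>\<partial>, \<partial>'\<close>.

  For compatibility, \<open>\<partial>\<close> acts on \<open>\<K>\<^sup>\<alpha>\<close> as multiplication by its coordinate \<open>p\<close>, and the diagonal
  part \<open>p/2\<close> of the connection accounts for this once in each argument of \<open>h\<close>.  The remaining part,
  \<open>d\<alpha>\<^sub>0 \<mapsto> -1/2 d\<alpha>\<^sub>k\<close>, contributes a multiple of \<open>h\<^sub>k\<^sub>0 + h\<^sub>0\<^sub>k\<close>, and this is zero.\<close>

section \<open>Coordinates of derivations and one-forms\<close>

definition der_of :: "complex \<Rightarrow> ('n::finite \<Rightarrow> complex) \<Rightarrow> 'n der" where
  "der_of p q = p *\<^sub>C dhat + (\<Sum>k\<in>UNIV. q k *\<^sub>C pd k)"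

definition form_of :: "('n::finite option \<Rightarrow> complex) \<Rightarrow> 'n form" where
  "form_of c = (\<Sum>I\<in>UNIV. c I *\<^sub>C dalpha g_inn I)"

lemma g_inn_eq_der_of: "D \<in> g_inn \<longleftrightarrow> (\<exists>p q. D = der_of p q)"
  by (auto simp: g_inn_span der_of_def)

lemma der_of_in [simp]: "der_of p q \<in> g_inn"
  by (auto simp: g_inn_eq_der_of)

lemma Omega1_eq_form_of: "\<omega> \<in> Omega1 g_inn \<longleftrightarrow> (\<exists>c. \<omega> = form_of c)"
proof
  assume "\<omega> \<in> Omega1 g_inn"
  then show "\<exists>c. \<omega> = form_of c" unfolding Omega1_basis form_of_def by blast
next
  assume "\<exists>c. \<omega> = form_of c"
  then show "\<omega> \<in> Omega1 g_inn" by (auto simp only: form_of_def Omega1_sum scaleC_dalpha_in)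
qed

lemma form_of_in [simp]: "form_of c \<in> Omega1 g_inn"
  by (auto simp: Omega1_eq_form_of)

lemma der_of_apply:
  "der_of p q a = Kn 0 0 (\<lambda>k. p * coefa a k + \<i> * coefe a * q k)"
  by (simp add: der_of_def sum_fun_apply kn_eq_iff)
    (simp add: dhat_def pd_def kn_defs if_distrib[of "\<lambda>x. _ * x"] algebra_simps cong: if_cong)

lemma form_of_apply:
  "form_of c (der_of p q) = Kn 0 0 (\<lambda>k. p * c (Some k) - c None * q k)"
  by (simp add: form_of_def sum_fun_apply sum_option dalpha_apply der_of_apply kn_eq_iff
      del: dalpha.simps)
    (simp add: kn_defs if_distrib[of "\<lambda>x. _ * x"] algebra_simps cong: if_cong)

lemma form_of_outside: "D \<notin> g_inn \<Longrightarrow> form_of c D = 0"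
  by (simp add: form_of_def sum_fun_apply dalpha_outside kn_eq_iff) (simp add: kn_defs)

lemma form_eqI:
  assumes "\<And>p q. \<omega> (der_of p q) = \<eta> (der_of p q)"
    and "\<And>D. D \<notin> g_inn \<Longrightarrow> \<omega> D = \<eta> D"
  shows "\<omega> = \<eta>"
proof
  fix D show "\<omega> D = \<eta> D"
    using assms by (cases "D \<in> g_inn") (auto simp: g_inn_eq_der_of)
qed

lemma form_of_add: "form_of c + form_of d = form_of (\<lambda>I. c I + d I)"
  by (rule form_eqI) (simp_all add: form_of_apply form_of_outside, simp add: kn_defs algebra_simps)

lemma form_of_scaleC: "x *\<^sub>C form_of c = form_of (\<lambda>I. x * c I)"
  by (rule form_eqI) (simp_all add: form_of_apply form_of_outside kn_defs algebra_simps)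

text \<open>The left action is by scalars because \<open>e \<alpha>\<^sub>k = \<alpha>\<^sub>k\<close> and \<open>\<alpha>\<^sub>j \<alpha>\<^sub>k = 0\<close>.\<close>

lemma lmul_form_of: "lmul a (form_of c) = (coef1 a + coefe a) *\<^sub>C form_of c"
  by (rule form_eqI) (simp_all add: lmul_def form_of_apply form_of_outside, simp_all add: kn_defs)

lemma der_star_der_of: "der_star (der_of p q) = der_of (cnj p) (\<lambda>k. cnj (q k))"
  by (rule ext) (simp add: der_star_def der_of_apply star_def algebra_simps)

lemma g_inn_der_star: "der_star D \<in> g_inn \<longleftrightarrow> D \<in> g_inn"
  by (metis der_of_in der_star_der_of der_star_der_star g_inn_eq_der_of)

lemma form_star_form_of: "form_star (form_of c) = form_of (\<lambda>I. cnj (c I))"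
proof (rule form_eqI)
  fix p q
  show "form_star (form_of c) (der_of p q) = form_of (\<lambda>I. cnj (c I)) (der_of p q)"
    by (simp add: form_star_def der_star_der_of form_of_apply star_def)
next
  fix D :: "'a der" assume "D \<notin> g_inn"
  then show "form_star (form_of c) D = form_of (\<lambda>I. cnj (c I)) D"
    by (simp add: form_star_def g_inn_der_star form_of_outside) (simp add: star_def zero_kn_def)
qed

lemma bracket_der_of:
  "bracket (der_of p q) (der_of p' q') = der_of 0 (\<lambda>k. p * q' k - p' * q k)"
  by (rule ext) (simp add: bracket_def der_of_apply kn_defs algebra_simps)

text \<open>Each \<open>d\<alpha>\<^sub>I\<close> is exact up to a scalar, and \<open>d\<^sup>2 = 0\<close>.\<close>

lemma ext_d_form_of: "ext_d (form_of c) (der_of p q) (der_of p' q') = 0"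
  by (simp add: ext_d_def bracket_der_of form_of_apply der_of_apply kn_defs algebra_simps)


section \<open>Bilinear maps and left connections\<close>

text \<open>Since \<open>\<partial>(a) \<omega> = 0\<close>, the derivation term of the Leibniz rule disappears.\<close>

lemma left_connection_of_bilinear:
  assumes "bilinear_map g_inn nabla"
  shows "left_connection g_inn nabla"
proof -
  have "lmul (D a) \<omega> = 0" if "D \<in> g_inn" "\<omega> \<in> Omega1 g_inn" for D :: "'a der" and a \<omega>
    using that by (auto simp: g_inn_eq_der_of Omega1_eq_form_of lmul_form_of der_of_apply)
      (auto simp: fun_eq_iff kn_defs)
  moreover have "lmul a \<omega> = (coef1 a + coefe a) *\<^sub>C \<omega>" if "\<omega> \<in> Omega1 g_inn" for \<omega> :: "'a form" and a
    using that by (auto simp: Omega1_eq_form_of lmul_form_of)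
  ultimately show ?thesis
    using assms unfolding left_connection_def bilinear_map_def by simp
qed

lemma scaleC_zero_left: "0 *\<^sub>C (\<omega> :: 'n::finite form) = 0"
  by (rule ext) (simp add: kn_defs)

lemma bilinear_map_expand:
  assumes nabla: "bilinear_map g_inn nabla"
  shows "nabla (der_of p q) (form_of c) = (\<Sum>I\<in>UNIV. c I *\<^sub>C
    (p *\<^sub>C nabla dhat (dalpha g_inn I) + (\<Sum>k\<in>UNIV. q k *\<^sub>C nabla (pd k) (dalpha g_inn I))))"
proof -
  have add1: "nabla (D + D') \<omega> = nabla D \<omega> + nabla D' \<omega>"
    if "D \<in> g_inn" "D' \<in> g_inn" "\<omega> \<in> Omega1 g_inn" for D D' \<omega>
    using nabla that unfolding bilinear_map_def by blast
  have add2: "nabla D (\<omega> + \<eta>) = nabla D \<omega> + nabla D \<eta>"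
    if "D \<in> g_inn" "\<omega> \<in> Omega1 g_inn" "\<eta> \<in> Omega1 g_inn" for D \<omega> \<eta>
    using nabla that unfolding bilinear_map_def by blast
  have scl1: "nabla (x *\<^sub>C D) \<omega> = x *\<^sub>C nabla D \<omega>"
    and scl2: "nabla D (x *\<^sub>C \<omega>) = x *\<^sub>C nabla D \<omega>"
    if "D \<in> g_inn" "\<omega> \<in> Omega1 g_inn" for D \<omega> x
    using nabla that unfolding bilinear_map_def by blast+
  have dalpha_in: "dalpha g_inn I \<in> Omega1 g_inn" for I :: "'a option"
    using scaleC_dalpha_in[of 1 g_inn I] by (simp add: scaleC_fun_def scaleC_kn_def)
  have scl_in: "x *\<^sub>C D \<in> g_inn" if "D \<in> g_inn" for x and D :: "'a der"
  proof -
    obtain p q where "D = der_of p q" using \<open>D \<in> g_inn\<close> by (auto simp: g_inn_eq_der_of)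
    then have "x *\<^sub>C D = der_of (x * p) (\<lambda>k. x * q k)"
      by (auto simp: fun_eq_iff der_of_apply kn_defs algebra_simps)
    then show ?thesis by simp
  qed
  have add_in: "D + D' \<in> g_inn" if D: "D \<in> g_inn" "D' \<in> g_inn" for D D' :: "'a der"
  proof -
    obtain p q p' q' where "D = der_of p q" "D' = der_of p' q'"
      using D unfolding g_inn_eq_der_of by blast
    then have "D + D' = der_of (p + p') (\<lambda>k. q k + q' k)"
      by (auto simp: fun_eq_iff der_of_apply kn_defs algebra_simps)
    then show ?thesis by simp
  qed
  have zero_scl: "0 *\<^sub>C D = (0 :: 'a der)" for D :: "'a der"
    by (rule ext) (simp add: kn_defs)
  have zero_in: "0 \<in> (g_inn :: 'a der set)"
    using scl_in[OF g_inn_memI(1), of 0] by (simp add: zero_scl)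
  have form0: "(0 :: 'a form) \<in> Omega1 g_inn"
    using Omega1_sum[of "{}"] by simp
  have sum_in: "(\<Sum>k\<in>S. q k *\<^sub>C pd k) \<in> g_inn" for S :: "'a set"
    by (induction S rule: infinite_finite_induct) (simp_all only: sum.infinite sum.empty sum.insert
        zero_in add_in scl_in g_inn_memI simp_thms)
  have right: "nabla D (\<Sum>I\<in>S. c I *\<^sub>C dalpha g_inn I) = (\<Sum>I\<in>S. c I *\<^sub>C nabla D (dalpha g_inn I))"
    if D: "D \<in> g_inn" for D and S :: "'a option set"
  proof (induction S rule: infinite_finite_induct)
    case empty
    show ?case using scl2[OF D form0, of 0] by (simp only: sum.empty scaleC_zero_left)
  next
    case (insert I S)
    then show ?case
      by (simp only: sum.insert not_False_eq_True add2[OF D] scl2[OF D] dalpha_in Omega1_sum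
          scaleC_dalpha_in)
  qed simp
  have left: "nabla (\<Sum>k\<in>S. q k *\<^sub>C pd k) \<omega> = (\<Sum>k\<in>S. q k *\<^sub>C nabla (pd k) \<omega>)"
    if w: "\<omega> \<in> Omega1 g_inn" for \<omega> and S :: "'a set"
  proof (induction S rule: infinite_finite_induct)
    case empty
    show ?case using scl1[OF zero_in w, of 0] by (simp only: sum.empty zero_scl scaleC_zero_left)
  next
    case (insert k S)
    then show ?case
      by (simp only: sum.insert not_False_eq_True add1[OF _ _ w] scl1[OF _ w] sum_in scl_in
          g_inn_memI)
  qed simp
  have "nabla (der_of p q) \<omega> = p *\<^sub>C nabla dhat \<omega> + (\<Sum>k\<in>UNIV. q k *\<^sub>C nabla (pd k) \<omega>)"
    if w: "\<omega> \<in> Omega1 g_inn" for \<omega>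
    unfolding der_of_def
    by (simp only: add1[OF _ _ w] scl1[OF _ w] left[OF w] sum_in scl_in g_inn_memI)
  then show ?thesis
    unfolding form_of_def[of c] by (simp only: right[OF der_of_in] dalpha_in)
qed


section \<open>The Levi-Civita connection\<close>

theorem mainTheorem2:
  fixes \<rho> :: "'n::finite option \<Rightarrow> real"
    and h0 :: "'n kn"
    and H :: "'n option \<Rightarrow> 'n option \<Rightarrow> 'n kn"
    and h :: "'n form \<Rightarrow> 'n form \<Rightarrow> 'n kn"
    and nabla :: "'n conn"
  assumes h0_span: "h0 \<in> Kalpha"
    and h0_star: "star h0 = h0"
    and H00: "H None None = complex_of_real (\<rho> None) *\<^sub>C h0"
    and H0k: "\<And>k. H None (Some k) = (- \<i> * complex_of_real (\<rho> (Some k))) *\<^sub>C h0"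
    and Hk0: "\<And>k. H (Some k) None = (\<i> * complex_of_real (\<rho> (Some k))) *\<^sub>C h0"
    and Hkl: "\<And>k l. H (Some k) (Some l) = 0"
    and h_eq: "\<And>(\<omega> :: 'n option \<Rightarrow> complex) (\<eta> :: 'n option \<Rightarrow> complex).
      h (\<Sum>I\<in>UNIV. \<omega> I *\<^sub>C dalpha g_inn I) (\<Sum>J\<in>UNIV. \<eta> J *\<^sub>C dalpha g_inn J)
        = (\<Sum>I\<in>UNIV. \<Sum>J\<in>UNIV. (\<omega> I * cnj (\<eta> J)) *\<^sub>C H I J)"
    and nabla_bilinear: "bilinear_map g_inn nabla"
    and nabla_dhat: "\<And>I. nabla dhat (dalpha g_inn I) = (1 / 2) *\<^sub>C dalpha g_inn I"
    and nabla_pd_0: "\<And>k. nabla (pd k) (dalpha g_inn None) = (- 1 / 2) *\<^sub>C dalpha g_inn (Some k)"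
    and nabla_pd: "\<And>k l. nabla (pd k) (dalpha g_inn (Some l)) = 0"
  shows "left_hermitian_form (Omega1 g_inn) h
    \<and> star_bimodule_connection g_inn nabla
    \<and> torsion_free g_inn nabla
    \<and> compatible g_inn nabla h"
proof -
  \<comment> \<open>The diagonal part \<open>p/2\<close> comes from \<open>dhat\<close>, the shift from \<open>d\<alpha>\<^sub>0\<close> to \<open>d\<alpha>\<^sub>k\<close> from \<open>\<partial>\<^sub>k\<close>.\<close>
  define G where "G p q c I =
      p * c I / 2 - (case I of None \<Rightarrow> 0 | Some k \<Rightarrow> q k * c None / 2)"
    for p and q :: "'n \<Rightarrow> complex" and c :: "'n option \<Rightarrow> complex" and I
  have G_simps: "G p q c None = p * c None / 2" "G p q c (Some k) = p * c (Some k) / 2 - q k * c None / 2"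
    for p q c k
    by (simp_all add: G_def)
  have nabla_eq: "nabla (der_of p q) (form_of c) = form_of (G p q c)" for p q c
    unfolding bilinear_map_expand[OF nabla_bilinear] unfolding form_of_def nabla_dhat
    by (rule ext) (simp add: sum_option nabla_pd_0 nabla_pd sum_fun_apply del: dalpha.simps,
        simp add: kn_eq_iff del: dalpha.simps,
        simp add: kn_defs G_def algebra_simps sum.distrib sum_subtractf sum_distrib_left
          sum_divide_distrib sum_negf del: dalpha.simps)

  have "coef1 h0 = 0" "coefe h0 = 0"
    using h0_span by (auto simp: Kalpha_def) (simp_all add: kn_defs)
  then obtain z where h0: "h0 = Kn 0 0 z"
    by (cases h0) auto
  have z_real: "cnj (z k) = z k" for k
    using h0_star by (auto simp: h0 star_def fun_eq_iff)
  define B where "B c d = of_real (\<rho> None) * c None * cnj (d None)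
      - \<i> * c None * (\<Sum>k\<in>UNIV. of_real (\<rho> (Some k)) * cnj (d (Some k)))
      + \<i> * cnj (d None) * (\<Sum>k\<in>UNIV. of_real (\<rho> (Some k)) * c (Some k))"
    for c d :: "'n option \<Rightarrow> complex"
  have h_form: "h (form_of c) (form_of d) = Kn 0 0 (\<lambda>k. B c d * z k)" for c d
    unfolding form_of_def h_eq
    by (simp add: sum_option H00 H0k Hk0 Hkl kn_eq_iff)
      (simp add: kn_defs h0 B_def algebra_simps sum.distrib sum_negf sum_distrib_left sum_distrib_right)
  have B_star: "cnj (B c d) = B d c" for c d
    by (simp add: B_def algebra_simps)
  have B_add: "B (\<lambda>I. c I + c' I) d = B c d + B c' d" for c c' d
    by (simp add: B_def algebra_simps sum.distrib)
  have B_scale: "B (\<lambda>I. x * c I) d = x * B c d" for x c d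
    by (simp add: B_def algebra_simps sum_distrib_left)
  have B_add': "B c (\<lambda>I. d I + d' I) = B c d + B c d'" for c d d'
    by (simp add: B_def algebra_simps sum.distrib)
  \<comment> \<open>The shift parts of the two terms on the left carry \<open>h\<^sub>k\<^sub>0\<close> and \<open>h\<^sub>0\<^sub>k\<close>, which are opposite, and
    cancel; conjugation in the second argument of \<open>B\<close> undoes that of \<open>p\<close> and \<open>q\<close>.\<close>
  have B_compat: "B (G p q c) d + B c (G (cnj p) (\<lambda>k. cnj (q k)) d) = p * B c d" for p q c d
    by (simp add: B_def G_simps algebra_simps sum.distrib sum_subtractf sum_distrib_left
        flip: sum_divide_distrib)

  have "left_hermitian_form (Omega1 g_inn) h"
    unfolding left_hermitian_form_def
    by (auto simp: Omega1_eq_form_of form_of_add lmul_form_of form_of_scaleC h_form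
        B_add B_add' B_scale star_def z_real B_star)
      (simp_all add: kn_defs algebra_simps)
  moreover have "star_bimodule_connection g_inn nabla"
    unfolding star_bimodule_connection_def
  proof (intro conjI ballI)
    show "left_connection g_inn nabla"
      by (rule left_connection_of_bilinear[OF nabla_bilinear])
    fix D \<omega> assume "D \<in> (g_inn :: 'n der set)" "\<omega> \<in> Omega1 (g_inn :: 'n der set)"
    then obtain p q c where "D = der_of p q" "\<omega> = form_of c"
      by (auto simp: g_inn_eq_der_of Omega1_eq_form_of)
    moreover have "(\<lambda>I. cnj (G p q c I)) = G (cnj p) (\<lambda>k. cnj (q k)) (\<lambda>I. cnj (c I))"
      by (rule ext) (simp add: G_def split: option.split)
    ultimately show "form_star (nabla D \<omega>) = nabla (der_star D) (form_star \<omega>)"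
      by (simp add: nabla_eq form_star_form_of der_star_der_of)
  qed
  moreover have "torsion_free g_inn nabla"
    unfolding torsion_free_def
    by (auto simp: g_inn_eq_der_of Omega1_eq_form_of nabla_eq ext_d_form_of form_of_apply G_simps)
      (simp add: kn_defs algebra_simps)
  moreover have "compatible g_inn nabla h"
    unfolding compatible_def
  proof (intro ballI)
    fix D \<omega> \<eta>
    assume "D \<in> (g_inn :: 'n der set)" "\<omega> \<in> Omega1 (g_inn :: 'n der set)"
      "\<eta> \<in> Omega1 (g_inn :: 'n der set)"
    then obtain p q c d where eqs: "D = der_of p q" "\<omega> = form_of c" "\<eta> = form_of d"
      unfolding g_inn_eq_der_of Omega1_eq_form_of by blast
    show "D (h \<omega> \<eta>) = h (nabla D \<omega>) \<eta> + h \<omega> (nabla (der_star D) \<eta>)"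
      by (simp add: eqs nabla_eq der_star_der_of h_form der_of_apply plus_kn_def)
        (simp add: B_compat flip: distrib_right mult.assoc)
  qed
  ultimately show ?thesis by blast
qed

end
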